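(* Let $n\ge 2$ and, for $k=0,1,\dots,n-1$, let $$\lambda_k=\frac1n\left(k-e^{-2\pi i/n}-e^{-4\pi i/n}-\dots-e^{-2k\pi i/n}\right)$$ (so $\lambda_0=0$ and $\lambda_{n-1}=1$). Let $S$ be the convex polygon with vertices $\lambda_0,\lambda_1,\dots,\lambda_{n-2},\lambda_{n-1},\bar\lambda_{n-2},\dots,\bar\lambda_1$. Then every point of $S$ is an eigenvalue of some standardized Laplacian matrix of order $n$.
   Context: A standardized Laplacian matrix of order $n$ is a real matrix $\tilde L=(\ell_{ij})\in\mathbb{R}^{n\times n}$ such that $-\frac1n\le \ell_{ij}\le 0$ for all $j\ne i$ and $\sum_{j=1}^n \ell_{ij}=0$ for every $i$. *)

theory Defs
  imports
    "HOL-Analysis.Convex"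
    "HOL-Analysis.Complex_Transcendental"
    "Jordan_Normal_Form.Char_Poly"
begin

text \<open>Rows and columns are indexed by \<open>0, \<dots>, n - 1\<close>.\<close>

definition std_laplacian :: "nat \<Rightarrow> real mat \<Rightarrow> bool" where
  "std_laplacian n L \<longleftrightarrow>
     L \<in> carrier_mat n n \<and>
     (\<forall>i<n. \<forall>j<n. j \<noteq> i \<longrightarrow> - (1 / real n) \<le> L $$ (i, j) \<and> L $$ (i, j) \<le> 0) \<and>
     (\<forall>i<n. (\<Sum>j<n. L $$ (i, j)) = 0)"

definition lap_vertex :: "nat \<Rightarrow> nat \<Rightarrow> complex" where
  "lap_vertex n k =
     (1 / of_nat n) *
     (of_nat k - (\<Sum>j = 1..k. exp (- (2 * of_nat j * of_real pi * \<i> / of_nat n))))"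

lemma lap_vertex_0: "lap_vertex n 0 = 0"
  by (simp add: lap_vertex_def)

lemma lap_vertex_last:
  assumes "n \<ge> 2"
  shows "lap_vertex n (n - 1) = 1"
proof -
  define w where "w = exp (- (2 * of_real pi * \<i> / of_nat n) :: complex)"
  have pw: "exp (- (2 * of_nat j * of_real pi * \<i> / of_nat n)) = w ^ j" for j
    unfolding w_def exp_of_nat_mult[symmetric] by (simp add: algebra_simps)
  have wn: "w ^ n = 1"
    using assms unfolding w_def exp_of_nat_mult[symmetric]
    by (simp add: exp_minus exp_two_pi_i)
  have "w \<noteq> 1"
  proof
    assume "w = 1"
    then obtain m :: int where "- (2 * pi / real n) = of_int (2 * m) * pi"
      unfolding w_def exp_eq_1 by auto
    then have "pi * (real_of_int (- m) * real n) = pi * 1"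
      using assms by (simp add: field_simps)
    then have "real_of_int (- m) * real n = 1"
      unfolding mult_cancel_left by simp
    then have "of_int (- m * int n) = (1 :: real)"
      by simp
    then have "- m * int n = 1"
      by (simp only: of_int_eq_1_iff)
    then have "int n dvd 1"
      by (metis dvd_triv_right)
    with assms show False
      by simp
  qed
  then have "(\<Sum>j<n. w ^ j) = 0"
    using wn by (simp add: geometric_sum)
  moreover have "{..<n} = insert 0 {1..n - 1}"
    using assms by auto
  ultimately have "(\<Sum>j = 1..n - 1. w ^ j) = - 1"
    by (simp add: eq_neg_iff_add_eq_0 add.commute)
  then show ?thesis
    using assms unfolding lap_vertex_def pw by (simp add: of_nat_diff)
qed

text \<open>The closed polygonal region, including its interior; for \<open>n = 2\<close> it degenerates to the
  segment from \<open>0\<close> to \<open>1\<close>.\<close>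

definition lap_polygon :: "nat \<Rightarrow> complex set" where
  "lap_polygon n =
     convex hull (lap_vertex n ` {0..n - 1} \<union> (\<lambda>k. cnj (lap_vertex n k)) ` {1..n - 2})"

end

theory Submission
  imports Defs
begin

text \<open>All circulant matrices share the eigenvector \<open>(1, w, \<dots>, w ^ (n - 1))\<close>, where \<open>w\<close> is a
  primitive \<open>n\<close>-th root of unity. For the circulant Laplacian with weights \<open>c m \<in> [0, 1/n]\<close> the
  eigenvalue \<open>\<Sum>m<n. c m * (1 - w ^ m)\<close> is linear in the weights, so these eigenvalues form a convex
  set. It contains \<open>\<lambda>\<^sub>k\<close> (weight \<open>1/n\<close> on \<open>m = 1, \<dots>, k\<close>) and its conjugate (weight \<open>1/n\<close> on
  \<open>m = n - k, \<dots>, n - 1\<close>), hence the whole polygon.\<close>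

text \<open>The index \<open>(j + n - i) mod n\<close> is the residue of \<open>j - i\<close>;
  adding \<open>n\<close> first keeps the subtraction on naturals from truncating.\<close>

definition circulant_laplacian :: "nat \<Rightarrow> (nat \<Rightarrow> real) \<Rightarrow> real mat" where
  "circulant_laplacian n c =
     mat n n (\<lambda>(i, j). (if i = j then \<Sum>m<n. c m else 0) - c ((j + n - i) mod n))"

text \<open>Subtracting \<open>i\<close> modulo \<open>n\<close> permutes the residues, with inverse
  \<open>m \<mapsto> (i + m) mod n\<close>. Since \<open>g\<close> sees both the offset and the
  column, this serves the row sums as well as the eigenvector equation.\<close>

lemma sum_cyclic_shift:
  fixes g :: "nat \<Rightarrow> nat \<Rightarrow> 'a :: comm_monoid_add"
  assumes "i < n"
  shows "(\<Sum>j<n. g ((j + n - i) mod n) j) = (\<Sum>m<n. g m ((i + m) mod n))"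
proof -
  have fwd: "(i + (j + n - i) mod n) mod n = j" if "j < n" for j
    using assms that by (simp add: mod_add_right_eq)
  have bwd: "((i + m) mod n + n - i) mod n = m" if "m < n" for m
    \<comment> \<open>As \<open>i + m < 2 * n\<close>, the sum either does not wrap around or wraps
      exactly once.\<close>
    using assms that by (cases "i + m < n") (auto simp: mod_if)
  show ?thesis
    using assms
    by (intro sum.reindex_bij_witness[where i = "\<lambda>m. (i + m) mod n"
          and j = "\<lambda>j. (j + n - i) mod n"]) (auto simp: fwd bwd)
qed

text \<open>Each row lists the weights in a rotated order, so their total cancels against the term
  added on the diagonal.\<close>

lemma std_laplacian_circulant:
  assumes "\<And>m. 0 \<le> c m" and "\<And>m. c m \<le> 1 / real n"
  shows "std_laplacian n (circulant_laplacian n c)"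
proof -
  have "(\<Sum>j<n. circulant_laplacian n c $$ (i, j)) = 0" if "i < n" for i
    using that sum_cyclic_shift[OF that, of "\<lambda>m _. c m"]
    by (simp add: circulant_laplacian_def sum_subtractf)
  then show ?thesis
    using assms by (auto simp: std_laplacian_def circulant_laplacian_def)
qed

lemma root_of_unity_power_mod:
  fixes w :: "'a :: monoid_mult"
  assumes "w ^ n = 1"
  shows "w ^ (a mod n) = w ^ a"
proof -
  have "w ^ a = w ^ (n * (a div n) + a mod n)"
    by simp
  then show ?thesis
    unfolding power_add power_mult assms by simp
qed

lemma eigenvalue_circulant_laplacian:
  fixes w :: complex
  assumes "n > 0" and wn: "w ^ n = 1"
  shows "eigenvalue (map_mat complex_of_real (circulant_laplacian n c))
           (\<Sum>m<n. of_real (c m) * (1 - w ^ m))"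
proof -
  let ?A = "map_mat complex_of_real (circulant_laplacian n c)"
  let ?v = "vec n (\<lambda>j. w ^ j)"
  let ?z = "\<Sum>m<n. of_real (c m) * (1 - w ^ m)"
  have "(\<Sum>j<n. ?A $$ (i, j) * w ^ j) = ?z * w ^ i" if i: "i < n" for i
  proof -
    have "(\<Sum>j<n. ?A $$ (i, j) * w ^ j) =
        (\<Sum>j<n. (if i = j then (\<Sum>m<n. of_real (c m)) * w ^ j else 0)
          - of_real (c ((j + n - i) mod n)) * w ^ j)"
      using i by (intro sum.cong) (auto simp: circulant_laplacian_def algebra_simps)
    also have "\<dots> = (\<Sum>m<n. of_real (c m)) * w ^ i
        - (\<Sum>j<n. of_real (c ((j + n - i) mod n)) * w ^ j)"
      using i by (simp add: sum_subtractf)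
    \<comment> \<open>Passing from column to offset turns \<open>w ^ j\<close> into
      \<open>w ^ ((i + m) mod n)\<close>, and \<open>w ^ n = 1\<close> removes the
      \<open>mod\<close>; then \<open>w ^ i\<close> factors out.\<close>
    also have "\<dots> = (\<Sum>m<n. of_real (c m)) * w ^ i
        - (\<Sum>m<n. of_real (c m) * w ^ (i + m))"
      using sum_cyclic_shift[OF i, of "\<lambda>m j. of_real (c m) * w ^ j"]
      by (simp add: root_of_unity_power_mod[OF wn])
    also have "\<dots> = ?z * w ^ i"
      unfolding sum_distrib_right sum_subtractf[symmetric]
      by (intro sum.cong) (auto simp: power_add algebra_simps)
    finally show ?thesis .
  qed
  then have "?A *\<^sub>v ?v = ?z \<cdot>\<^sub>v ?v"
    by (intro eq_vecI)
      (auto simp: circulant_laplacian_def scalar_prod_def atLeast0LessThan)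
  \<comment> \<open>The entry at index 0 is \<open>w ^ 0 = 1\<close>.\<close>
  moreover have "?v \<noteq> 0\<^sub>v n"
    using \<open>n > 0\<close> by (metis index_vec index_zero_vec(1) power_0 zero_neq_one)
  ultimately show ?thesis
    unfolding eigenvalue_def eigenvector_def
    by (intro exI[of _ ?v]) (auto simp: circulant_laplacian_def)
qed

text \<open>The bounds range over all \<open>m\<close> to match the hypotheses of
  \<open>std_laplacian_circulant\<close>.\<close>

definition circulant_spectrum :: "nat \<Rightarrow> complex \<Rightarrow> complex set" where
  "circulant_spectrum n w =
     (\<lambda>c. \<Sum>m<n. of_real (c m) * (1 - w ^ m)) ` {c. \<forall>m. 0 \<le> c m \<and> c m \<le> 1 / real n}"

lemma convex_circulant_spectrum: "convex (circulant_spectrum n w)"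
proof (rule convexI)
  fix x y :: complex and u v :: real
  assume "x \<in> circulant_spectrum n w" "y \<in> circulant_spectrum n w"
    and uv: "0 \<le> u" "0 \<le> v" "u + v = 1"
  then obtain c d where c: "\<forall>m. 0 \<le> c m \<and> c m \<le> 1 / real n"
      and x: "x = (\<Sum>m<n. of_real (c m) * (1 - w ^ m))"
      and d: "\<forall>m. 0 \<le> d m \<and> d m \<le> 1 / real n"
      and y: "y = (\<Sum>m<n. of_real (d m) * (1 - w ^ m))"
    unfolding circulant_spectrum_def by blast
  have "u *\<^sub>R x + v *\<^sub>R y = (\<Sum>m<n. of_real (u * c m + v * d m) * (1 - w ^ m))"
    by (simp add: x y scaleR_conv_of_real sum_distrib_left sum.distrib[symmetric] algebra_simps)
  moreover have "0 \<le> u * c m + v * d m \<and> u * c m + v * d m \<le> 1 / real n" for m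
    using c d uv by (simp add: convex_bound_le)
  ultimately show "u *\<^sub>R x + v *\<^sub>R y \<in> circulant_spectrum n w"
    unfolding circulant_spectrum_def
    by (intro image_eqI[where x = "\<lambda>m. u * c m + v * d m"]) auto
qed

lemma circulant_spectrum_subset_sum:
  assumes "A \<subseteq> {..<n}"
  shows "(\<Sum>m\<in>A. (1 / of_nat n) * (1 - w ^ m)) \<in> circulant_spectrum n w"
proof -
  let ?c = "\<lambda>m. if m \<in> A then 1 / real n else 0"
  have "(\<Sum>m<n. of_real (?c m) * (1 - w ^ m)) = (\<Sum>m\<in>A. (1 / of_nat n) * (1 - w ^ m))"
    using assms by (intro sum.mono_neutral_cong_right) auto
  moreover have "\<forall>m. 0 \<le> ?c m \<and> ?c m \<le> 1 / real n"
    by simp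
  ultimately show ?thesis
    unfolding circulant_spectrum_def by (intro image_eqI[where x = ?c]) auto
qed

lemma exp_root_of_unity:
  assumes "n > 0"
  shows "exp (- (2 * of_real pi * \<i> / of_nat n) :: complex) ^ n = 1"
  using assms unfolding exp_of_nat_mult[symmetric] by (simp add: exp_minus)

lemma lap_vertex_eq_sum:
  "lap_vertex n k =
     (\<Sum>m = 1..k. (1 / of_nat n) * (1 - exp (- (2 * of_real pi * \<i> / of_nat n)) ^ m))"
proof -
  have "exp (- (2 * of_nat j * of_real pi * \<i> / of_nat n)) =
      exp (- (2 * of_real pi * \<i> / of_nat n) :: complex) ^ j" for j
    unfolding exp_of_nat_mult[symmetric] by (simp add: algebra_simps)
  then show ?thesis
    unfolding lap_vertex_def sum_distrib_left[symmetric] by (simp add: sum_subtractf)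
qed

text \<open>Both sides are the inverse of \<open>w ^ m\<close>: the left one because
  \<open>w\<close> lies on the unit circle, the right one because \<open>w ^ n = 1\<close>.\<close>

lemma cnj_root_of_unity_power:
  assumes "w ^ n = 1" and "cnj w * w = 1" and "m \<le> n"
  shows "cnj (w ^ m) = w ^ (n - m)"
proof -
  have "cnj (w ^ m) = cnj (w ^ m) * (w ^ m * w ^ (n - m))"
    using assms(1,3) by (simp add: power_add[symmetric])
  also have "\<dots> = (cnj w * w) ^ m * w ^ (n - m)"
    by (simp add: power_mult_distrib)
  finally show ?thesis
    by (simp add: assms(2))
qed

lemma lap_polygon_subset_circulant_spectrum:
  assumes "n > 0"
  shows "lap_polygon n \<subseteq> circulant_spectrum n (exp (- (2 * of_real pi * \<i> / of_nat n)))"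
proof -
  define w where "w = exp (- (2 * of_real pi * \<i> / of_nat n) :: complex)"
  have wn: "w ^ n = 1"
    using exp_root_of_unity[OF assms] by (simp add: w_def)
  have cw: "cnj w * w = 1"
    unfolding w_def exp_cnj exp_add[symmetric] by simp
  have vertex: "lap_vertex n k \<in> circulant_spectrum n w" if "k \<le> n - 1" for k
    unfolding lap_vertex_eq_sum w_def[symmetric]
    using that assms by (intro circulant_spectrum_subset_sum) auto
  have cnj_vertex: "cnj (lap_vertex n k) \<in> circulant_spectrum n w" if "k \<le> n - 1" for k
  proof -
    have "cnj (lap_vertex n k) = (\<Sum>m = 1..k. (1 / of_nat n) * (1 - w ^ (n - m)))"
      unfolding lap_vertex_eq_sum w_def[symmetric] cnj_sum
      using that cnj_root_of_unity_power[OF wn cw] by (intro sum.cong) auto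
    \<comment> \<open>The reflection \<open>m \<mapsto> n - m\<close> carries \<open>{1..k}\<close>
      onto \<open>{n - k..n - 1}\<close>, again a set of indices below \<open>n\<close>.\<close>
    also have "\<dots> = (\<Sum>m = n - k..n - 1. (1 / of_nat n) * (1 - w ^ m))"
      using that assms
      by (intro sum.reindex_bij_witness[where i = "\<lambda>m. n - m" and j = "\<lambda>m. n - m"]) auto
    also have "\<dots> \<in> circulant_spectrum n w"
      using assms by (intro circulant_spectrum_subset_sum) auto
    finally show ?thesis .
  qed
  show ?thesis
    unfolding lap_polygon_def w_def[symmetric]
    \<comment> \<open>A convex set containing all the vertices contains their hull.\<close>
    using vertex cnj_vertex by (intro hull_minimal convex_circulant_spectrum) auto
qed

theorem theorem6:
  fixes n :: nat and z :: complex
  assumes "n \<ge> 2"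
    and "z \<in> lap_polygon n"
  shows "\<exists>L :: real mat. std_laplacian n L \<and> eigenvalue (map_mat complex_of_real L) z"
proof -
  define w where "w = exp (- (2 * of_real pi * \<i> / of_nat n) :: complex)"
  have "w ^ n = 1"
    using exp_root_of_unity[of n] assms(1) by (simp add: w_def)
  moreover obtain c where c: "\<forall>m. 0 \<le> c m \<and> c m \<le> 1 / real n"
      and z: "z = (\<Sum>m<n. of_real (c m) * (1 - w ^ m))"
    using assms lap_polygon_subset_circulant_spectrum[of n]
    unfolding circulant_spectrum_def w_def by auto
  ultimately show ?thesis
    using assms(1) std_laplacian_circulant[of c n] eigenvalue_circulant_laplacian[of n w c]
    by auto
qed

end
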